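(* Consider a sequence $\{\theta_k\}_{k \in \mathbb{N}}$ generated by the mixture-based ML algorithm (defined in the context) with $\theta_k = ( \{\lambda_k^{(j)}\}_{j=1}^J, \{\vartheta_k^{(j)}\}_{j=1}^J )$ for every $k\in \mathbb{N}$. Suppose that, at every iteration $k$ and for every $j=1,\dots,J$, the maximization problem $$\operatorname*{maximize}_{\vartheta\in\Theta}\ \mathbb{E}_{X \sim \pi_{\theta_k}^f} [\ln (p_{\vartheta}(X))\, \rho_k^{(j)}(X)]$$ has a unique maximizer. Then, at every iteration $k \in \mathbb{N}$, the algorithm achieves the decrease $$KL \left(\pi_{\theta_k}^f, p_{\theta_{k+1}} \right) + \Delta_k \leq KL \left(\pi_{\theta_k}^f, p_{\theta_k} \right),$$ for some $\Delta_k > 0$, unless $\lambda_{k+1}^{(j)} = \lambda_k^{(j)}$ and $\vartheta_{k+1}^{(j)} = \vartheta_k^{(j)}$ for every $j =1,\dots,J$, in which case $\Delta_k = 0$.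
   Context: Setting: $\mathbb{X}$ is a measurable space with a measure $m$, $f:\mathbb{X}\to\mathbb{R}$ is an objective function, and $\{p_\vartheta,\ \vartheta\in\Theta\}$ is a parametric family of probability densities on $\mathbb{X}$ with respect to $m$ (the mixture components). The proposals are mixtures with $J$ components $p_\theta=\sum_{j=1}^J\lambda^{(j)}p_{\vartheta^{(j)}}$, with $\lambda^{(j)}\in[0,1]$, $\sum_{j=1}^J\lambda^{(j)}=1$, $\vartheta^{(j)}\in\Theta$, and global parameter $\theta=(\{\lambda^{(j)}\}_{j=1}^J,\{\vartheta^{(j)}\}_{j=1}^J)$. For a mixture proposal $p_\theta$ and $x\in\mathbb{X}$, set $q_\theta^{<}(x) = \mathbb{P}_{X\sim p_\theta}[f(X)<f(x)]$ and $q_\theta^{\leq}(x) = \mathbb{P}_{X\sim p_\theta}[f(X)\leq f(x)]$. Let $w:[0,1]\to\mathbb{R}_+$ be non-increasing and $Z_w=\int_0^1 w(u)\,du$ (assumed positive so that the target density is defined). Define $W_\theta^f(x) = w(q_\theta^{\leq}(x))$ if $q_\theta^{\leq}(x)=q_\theta^{<}(x)$, and $W_\theta^f(x) = \frac{1}{q_\theta^{\leq}(x)-q_\theta^{<}(x)}\int_{q_\theta^{<}(x)}^{q_\theta^{\leq}(x)} w(u)\,du$ otherwise. The target density is $\pi_\theta^f(x)=\frac{1}{Z_w}W_\theta^f(x)p_\theta(x)$, which is a probability density with respect to $m$. Divergence: for probability densities $p_1,p_2$ with respect to $m$, $KL(p_1,p_2)=\int \ln\left(\frac{p_1(x)}{p_2(x)}\right)p_1(x)\,m(dx)$,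 with $\ln(p_1(x))p_1(x)=0$ when $p_1(x)=0$. Mixture-based ML algorithm: initialize $\theta_0=(\{\lambda_0^{(j)}\}_{j=1}^J,\{\vartheta_0^{(j)}\}_{j=1}^J)$. For $k=0,1,\dots$, define for each $j=1,\dots,J$ and $x\in\mathbb{X}$ $$\rho_k^{(j)}(x)=\frac{\lambda_k^{(j)}p_{\vartheta_k^{(j)}}(x)}{\sum_{i=1}^J\lambda_k^{(i)}p_{\vartheta_k^{(i)}}(x)},$$ and update, for every $j=1,\dots,J$, $$\lambda_{k+1}^{(j)}=\mathbb{E}_{X\sim\pi_{\theta_k}^f}[\rho_k^{(j)}(X)],\qquad \vartheta_{k+1}^{(j)}=\operatorname*{arg\,max}_{\vartheta\in\Theta}\ \mathbb{E}_{X\sim\pi_{\theta_k}^f}[\ln (p_\vartheta(X))\,\rho_k^{(j)}(X)].$$ *)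

theory Defs
  imports "HOL-Analysis.Analysis"
begin

text \<open>
  Logarithms of densities take the value \<open>-\<infinity>\<close> where a density vanishes, so they are
  extended-real valued; the library's \<^const>\<open>ln\<close> has \<open>ln 0 = 0\<close> instead.
\<close>

definition eln :: "ereal \<Rightarrow> ereal" where
  "eln x = (if x \<le> 0 then -\<infinity> else if x = \<infinity> then \<infinity> else ereal (ln (real_of_ereal x)))"

text \<open>
  The integral as the positive part minus the negative part (\<^const>\<open>e2ennreal\<close> maps negative
  numbers to \<open>0\<close>).  It is the usual integral with values in \<open>[-\<infinity>, \<infinity>]\<close> whenever one of
  the parts is finite; when both are infinite and no integral exists, \<^typ>\<open>ereal\<close>'s
  \<open>\<infinity> - \<infinity> = \<infinity>\<close> makes it \<open>\<infinity>\<close>.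
\<close>

definition ext_integral :: "'a measure \<Rightarrow> ('a \<Rightarrow> ereal) \<Rightarrow> ereal" where
  "ext_integral N g =
     enn2ereal (\<integral>\<^sup>+ x. e2ennreal (g x) \<partial>N) - enn2ereal (\<integral>\<^sup>+ x. e2ennreal (- g x) \<partial>N)"

definition prob_density :: "'a measure \<Rightarrow> ('a \<Rightarrow> real) \<Rightarrow> bool" where
  "prob_density M g \<longleftrightarrow>
     g \<in> borel_measurable M \<and> (\<forall>x\<in>space M. 0 \<le> g x) \<and> (\<integral>\<^sup>+ x. ennreal (g x) \<partial>M) = 1"

text \<open>
  In \<^typ>\<open>ereal\<close>, \<open>a / 0 = \<infinity>\<close> for \<open>a > 0\<close>, and \<open>0 / b = 0\<close>, \<open>-\<infinity> * 0 = 0\<close>.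
  So the integrand below is \<open>\<infinity>\<close> where \<open>p1 > 0 = p2\<close>, and \<open>0\<close> where \<open>p1 = 0\<close>.
\<close>

definition KL :: "'a measure \<Rightarrow> ('a \<Rightarrow> real) \<Rightarrow> ('a \<Rightarrow> real) \<Rightarrow> ereal" where
  "KL M p1 p2 = ext_integral M (\<lambda>x. eln (ereal (p1 x) / ereal (p2 x)) * ereal (p1 x))"

text \<open>
  A mixture parameter is a pair of the weights and the component parameters, both indexed by
  \<open>{1..J}\<close>; values outside this index set are never used.
\<close>

type_synonym 'b mixture_param = "(nat \<Rightarrow> real) \<times> (nat \<Rightarrow> 'b)"

definition mixture_params :: "nat \<Rightarrow> 'b set \<Rightarrow> 'b mixture_param set" where
  "mixture_params J \<Theta> = {(lam, th).
     (\<forall>j\<in>{1..J}. lam j \<in> {0..1} \<and> th j \<in> \<Theta>) \<and> (\<Sum>j=1..J. lam j) = 1}"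

definition mixture :: "('b \<Rightarrow> 'a \<Rightarrow> real) \<Rightarrow> nat \<Rightarrow> 'b mixture_param \<Rightarrow> 'a \<Rightarrow> real" where
  "mixture p J \<theta> x = (\<Sum>j=1..J. fst \<theta> j * p (snd \<theta> j) x)"

definition q_less ::
  "'a measure \<Rightarrow> ('a \<Rightarrow> real) \<Rightarrow> ('b \<Rightarrow> 'a \<Rightarrow> real) \<Rightarrow> nat \<Rightarrow> 'b mixture_param \<Rightarrow> 'a \<Rightarrow> real" where
  "q_less M f p J \<theta> x =
     measure (density M (\<lambda>y. ennreal (mixture p J \<theta> y))) {y \<in> space M. f y < f x}"

definition q_le ::
  "'a measure \<Rightarrow> ('a \<Rightarrow> real) \<Rightarrow> ('b \<Rightarrow> 'a \<Rightarrow> real) \<Rightarrow> nat \<Rightarrow> 'b mixture_param \<Rightarrow> 'a \<Rightarrow> real" where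
  "q_le M f p J \<theta> x =
     measure (density M (\<lambda>y. ennreal (mixture p J \<theta> y))) {y \<in> space M. f y \<le> f x}"

definition W_f ::
  "'a measure \<Rightarrow> ('a \<Rightarrow> real) \<Rightarrow> (real \<Rightarrow> real) \<Rightarrow> ('b \<Rightarrow> 'a \<Rightarrow> real) \<Rightarrow> nat \<Rightarrow> 'b mixture_param
     \<Rightarrow> 'a \<Rightarrow> real" where
  "W_f M f w p J \<theta> x =
     (let a = q_less M f p J \<theta> x; b = q_le M f p J \<theta> x
      in if b = a then w b else 1 / (b - a) * (LBINT u:{a..b}. w u))"

definition Z_w :: "(real \<Rightarrow> real) \<Rightarrow> real" where
  "Z_w w = (LBINT u:{0..1}. w u)"

definition target ::
  "'a measure \<Rightarrow> ('a \<Rightarrow> real) \<Rightarrow> (real \<Rightarrow> real) \<Rightarrow> ('b \<Rightarrow> 'a \<Rightarrow> real) \<Rightarrow> nat \<Rightarrow> 'b mixture_param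
     \<Rightarrow> 'a \<Rightarrow> real" where
  "target M f w p J \<theta> x = 1 / Z_w w * W_f M f w p J \<theta> x * mixture p J \<theta> x"

definition target_measure ::
  "'a measure \<Rightarrow> ('a \<Rightarrow> real) \<Rightarrow> (real \<Rightarrow> real) \<Rightarrow> ('b \<Rightarrow> 'a \<Rightarrow> real) \<Rightarrow> nat \<Rightarrow> 'b mixture_param
     \<Rightarrow> 'a measure" where
  "target_measure M f w p J \<theta> = density M (\<lambda>x. ennreal (target M f w p J \<theta> x))"

text \<open>
  Where the mixture vanishes this is \<open>0 / 0 = 0\<close>; that set is null for the target measure.
\<close>

definition resp :: "('b \<Rightarrow> 'a \<Rightarrow> real) \<Rightarrow> nat \<Rightarrow> 'b mixture_param \<Rightarrow> nat \<Rightarrow> 'a \<Rightarrow> real" where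
  "resp p J \<theta> j x = fst \<theta> j * p (snd \<theta> j) x / (\<Sum>i=1..J. fst \<theta> i * p (snd \<theta> i) x)"

text \<open>The integrand is \<open>0\<close> where \<open>resp p J \<theta> j x = 0\<close>, even if \<open>p t x = 0\<close>.\<close>

definition objective ::
  "'a measure \<Rightarrow> ('a \<Rightarrow> real) \<Rightarrow> (real \<Rightarrow> real) \<Rightarrow> ('b \<Rightarrow> 'a \<Rightarrow> real) \<Rightarrow> nat \<Rightarrow> 'b mixture_param
     \<Rightarrow> nat \<Rightarrow> 'b \<Rightarrow> ereal" where
  "objective M f w p J \<theta> j t =
     ext_integral (target_measure M f w p J \<theta>) (\<lambda>x. eln (ereal (p t x)) * ereal (resp p J \<theta> j x))"

definition mixture_ML_sequence ::
  "'a measure \<Rightarrow> ('a \<Rightarrow> real) \<Rightarrow> (real \<Rightarrow> real) \<Rightarrow> ('b \<Rightarrow> 'a \<Rightarrow> real) \<Rightarrow> 'b set \<Rightarrow> nat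
     \<Rightarrow> (nat \<Rightarrow> 'b mixture_param) \<Rightarrow> bool" where
  "mixture_ML_sequence M f w p \<Theta> J \<theta> \<longleftrightarrow>
     \<theta> 0 \<in> mixture_params J \<Theta> \<and>
     (\<forall>k. \<forall>j\<in>{1..J}.
        fst (\<theta> (Suc k)) j = (\<integral>x. resp p J (\<theta> k) j x \<partial>target_measure M f w p J (\<theta> k)) \<and>
        is_arg_max (objective M f w p J (\<theta> k) j) (\<lambda>t. t \<in> \<Theta>) (snd (\<theta> (Suc k)) j))"

end

theory Submission
  imports Defs "HOL-Probability.Weak_Convergence"
begin

text \<open>
  One iteration is an EM step for the target \<open>\<pi>\<close>.  By concavity of the logarithm, replacing the
  mixture \<open>q\<close> by \<open>q'\<close> raises \<open>\<integral> \<pi> ln q\<close> by at least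
  \<open>\<Sum>j. \<integral> \<pi> \<rho>\<^sub>j ln (l' j / l j) + \<Sum>j. \<integral> \<pi> \<rho>\<^sub>j (ln (p (t' j)) - ln (p (t j)))\<close>.
  Since \<open>l' j = \<integral> \<pi> \<rho>\<^sub>j\<close>, the first sum is the relative entropy of the two weight vectors, which
  is positive unless they coincide; each term of the second sum is positive unless the parameter
  does not move, because the maximizer is unique.  That \<open>l'\<close> sums to \<open>1\<close> rests on \<open>\<pi>\<close> being a
  probability density, which is seen by realising the law of \<open>f\<close> under \<open>q\<close> as the quantile
  function of a uniform variable.  As \<open>\<pi>\<close> is bounded by a multiple of \<open>q\<close>, all the integrals involved are finite
  whenever a component moves.
\<close>

section \<open>Averages of a weight over the jumps of a distribution function\<close>

text \<open>The body of \<open>W_f\<close> with \<open>q_less\<close> and \<open>q_le\<close>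
  replaced by free reals, so that it can be studied on the range of the objective function, away
  from the space \<open>M\<close>.\<close>

definition window_avg :: "(real \<Rightarrow> real) \<Rightarrow> real \<Rightarrow> real \<Rightarrow> real" where
  "window_avg w a b = (if b = a then w b else 1 / (b - a) * (LBINT u:{a..b}. w u))"

lemma borel_measurable_antimono:
  fixes w :: "real \<Rightarrow> real"
  assumes "antimono w"
  shows "w \<in> borel_measurable borel"
proof -
  have "mono (\<lambda>u. - w u)"
    using assms by (auto simp: monotone_def)
  then have "(\<lambda>u. - w u) \<in> borel_measurable borel"
    by (rule borel_measurable_mono)
  then show ?thesis
    by simp
qed

lemma antimono_set_integrable:
  fixes w :: "real \<Rightarrow> real"
  assumes "antimono w" "\<And>u. 0 \<le> w u"
  shows "set_integrable lborel {a..b} w"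
  unfolding set_integrable_def
proof (rule integrableI_bounded_set[where A = "{a..b}" and B = "w a"])
  have [measurable]: "w \<in> borel_measurable borel"
    by (rule borel_measurable_antimono) fact
  show "(\<lambda>u. indicat_real {a..b} u *\<^sub>R w u) \<in> borel_measurable lborel"
    by measurable
  show "AE u in lborel. u \<in> {a..b} \<longrightarrow> norm (indicat_real {a..b} u *\<^sub>R w u) \<le> w a"
    using assms by (auto simp: antimono_def)
qed (auto simp: emeasure_lborel_Icc_eq)

lemma window_avg_bounds:
  fixes w :: "real \<Rightarrow> real"
  assumes w: "antimono w" "\<And>u. 0 \<le> w u" and ab: "a \<le> b"
  shows "w b \<le> window_avg w a b" "window_avg w a b \<le> w a"
proof -
  have c: "(LBINT u:{a..b}. c) = c * (b - a)" for c :: real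
    using ab by (simp add: set_lebesgue_integral_def)
  have i: "set_integrable lborel {a..b} (\<lambda>u. c)" for c :: real
    unfolding set_integrable_def real_scaleR_def
    by (intro integrable_mult_left integrable_real_indicator) (simp_all add: emeasure_lborel_Icc_eq)
  note s = antimono_set_integrable[OF w]
  have "w b * (b - a) \<le> (LBINT u:{a..b}. w u)"
    unfolding c[symmetric] using w by (intro set_integral_mono i s) (auto simp: antimono_def)
  then show "w b \<le> window_avg w a b"
    using ab by (auto simp: window_avg_def field_simps)
  have "(LBINT u:{a..b}. w u) \<le> w a * (b - a)"
    unfolding c[symmetric] using w by (intro set_integral_mono i s) (auto simp: antimono_def)
  then show "window_avg w a b \<le> w a"
    using ab by (auto simp: window_avg_def field_simps)
qed

text \<open>For \<open>x < y\<close> the window at \<open>x\<close> ends no later than the window at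
  \<open>y\<close> begins, since \<open>{..x}\<close> is contained in \<open>{..<y}\<close>; values
  of \<open>w\<close> at these two ends separate the averages. Monotonicity is what yields Borel
  measurability in \<open>y\<close>.\<close>

lemma antimono_window_avg_cdf:
  fixes w :: "real \<Rightarrow> real"
  assumes w: "antimono w" "\<And>u. 0 \<le> w u" and N: "real_distribution N"
  shows "antimono (\<lambda>y. window_avg w (measure N {..<y}) (measure N {..y}))"
proof (rule antimonoI)
  fix x y :: real assume "x \<le> y"
  interpret real_distribution N by fact
  note b = window_avg_bounds[OF w]
  show "window_avg w (measure N {..<y}) (measure N {..y})
      \<le> window_avg w (measure N {..<x}) (measure N {..x})"
  proof (cases "x = y")
    case False
    have "window_avg w (measure N {..<y}) (measure N {..y}) \<le> w (measure N {..<y})"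
      by (intro b finite_measure_mono) auto
    also have "\<dots> \<le> w (measure N {..x})"
      using False \<open>x \<le> y\<close> by (intro antimonoD[OF w(1)] finite_measure_mono) auto
    also have "\<dots> \<le> window_avg w (measure N {..<x}) (measure N {..x})"
      by (intro b finite_measure_mono) auto
    finally show ?thesis .
  qed simp
qed

section \<open>The quantile function of a uniform variable\<close>

context cdf_distribution
begin

text \<open>The equivalence \<open>u \<le> cdf M y\<close> iff \<open>I u \<le> y\<close> gives the
  upper bound at \<open>y = I u\<close>. Below \<open>I u\<close> it gives
  \<open>cdf M y \<le> u\<close>, which survives in the left limit.\<close>

lemma cdf_pseudoinverse_bounds:
  assumes "0 < u" "u < 1"
  shows "measure M {..<I u} \<le> u" "u \<le> measure M {..I u}"
proof -
  show "u \<le> measure M {..I u}"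
    using pseudoinverse[OF assms, of "I u"] by (simp add: cdf_def)
  have "cdf M y \<le> u" if "y < I u" for y
    using pseudoinverse[OF assms, of y] that by linarith
  then have "eventually (\<lambda>y. cdf M y \<le> u) (at_left (I u))"
    by (simp add: eventually_at_filter)
  then show "measure M {..<I u} \<le> u"
    by (intro tendsto_upperbound[OF cdf_at_left]) simp_all
qed

text \<open>If \<open>I u\<close> were smaller than \<open>y\<close>, the distribution function at
  \<open>I u\<close> would be at most its left limit at \<open>y\<close>, hence below
  \<open>u\<close>. Thus every level strictly inside the jump at \<open>y\<close> is sent to
  \<open>y\<close>.\<close>

lemma pseudoinverse_eqI:
  assumes "0 < u" "u < 1" "measure M {..<y} < u" "u < measure M {..y}"
  shows "I u = y"
proof (rule antisym)
  show "I u \<le> y"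
    using pseudoinverse[OF assms(1,2), of y] assms(4) by (simp add: cdf_def)
  show "y \<le> I u"
  proof (rule ccontr)
    assume "\<not> y \<le> I u"
    then have "measure M {..I u} \<le> measure M {..<y}"
      by (intro finite_measure_mono) auto
    with cdf_pseudoinverse_bounds[OF assms(1,2)] assms(3) show False
      by linarith
  qed
qed

text \<open>
  A uniform variable \<open>u\<close> lies between the left limit and the value of the distribution
  function at its quantile \<open>I u\<close>.  Off the atoms the two coincide with \<open>u\<close>; the preimage of
  an atom is the whole window over which \<open>w\<close> is averaged.
\<close>

lemma nn_integral_window_avg_cdf:
  fixes w :: "real \<Rightarrow> real"
  assumes w: "antimono w" "\<And>u. 0 \<le> w u"
  shows "(\<integral>\<^sup>+ y. ennreal (window_avg w (measure M {..<y}) (measure M {..y})) \<partial>M)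
    = ennreal (LBINT u:{0..1}. w u)"
proof -
  let ?a = "\<lambda>y. measure M {..<y}" and ?b = "\<lambda>y. measure M {..y}"
  let ?h = "\<lambda>y. window_avg w (?a y) (?b y)"
  \<comment> \<open>The uniform law lives on the open interval because \<open>I u\<close> is
    characterised only for \<open>0 < u < 1\<close>; the endpoints are null and are restored at the
    end.\<close>
  define \<Omega> where "\<Omega> = restrict_space lborel {0<..<1::real}"
  define S where "S = {y. ?a y \<noteq> ?b y}"
  have [measurable]: "w \<in> borel_measurable borel" "?h \<in> borel_measurable borel"
    using borel_measurable_antimono w antimono_window_avg_cdf[OF w real_distribution_axioms] by auto
  have [measurable]: "I \<in> measurable \<Omega> borel"
    using measurable_CI by (simp add: \<Omega>_def measurable_cong_sets[OF sets_restrict_space_cong[OF sets_lborel] refl])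
  have [measurable]: "w \<in> borel_measurable \<Omega>"
    by (simp add: \<Omega>_def measurable_restrict_space1)
  have sp: "space \<Omega> = {0<..<1}"
    by (simp add: \<Omega>_def space_restrict_space)
  have jump: "?b y = ?a y + measure M {y}" for y
  proof -
    have "{..y} = {..<y} \<union> {y}"
      by auto
    then show ?thesis
      using finite_measure_Union[of "{..<y}" "{y}"] by simp
  qed
  have cS: "countable S"
    using countable_support by (rule countable_subset[rotated]) (auto simp: S_def jump)
  have ab: "?a y \<le> ?b y" for y
    by (simp add: jump)
  have h0: "0 \<le> ?h y" for y
    using window_avg_bounds(1)[OF w ab] w(2) order_trans by blast
  \<comment> \<open>The claim becomes equality of the total masses of these two measures. They are
    compared on each fibre of \<open>I\<close> over the countable jump set \<open>S\<close> and on
    the remainder \<open>?B\<close>.\<close>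
  let ?\<mu> = "density \<Omega> (\<lambda>u. ennreal (?h (I u)))" and ?\<nu> = "density \<Omega> (\<lambda>u. ennreal (w u))"
  let ?A = "\<lambda>y. {u \<in> space \<Omega>. I u = y}" and ?B = "{u \<in> space \<Omega>. I u \<notin> S}"
  have A[measurable]: "?A y \<in> sets \<Omega>" for y
    by measurable
  have UA: "(\<Union>y\<in>S. ?A y) \<in> sets \<Omega>"
    using cS by (intro sets.countable_UN') auto
  have "?B = space \<Omega> - (\<Union>y\<in>S. ?A y)"
    by auto
  with UA have B[measurable]: "?B \<in> sets \<Omega>"
    by auto
  have atom: "emeasure ?\<mu> (?A y) = emeasure ?\<nu> (?A y)" if "y \<in> S" for y
  proof -
    have lt: "?a y < ?b y"
      using that ab[of y] by (auto simp: S_def)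
    \<comment> \<open>At the two ends of the window \<open>I u\<close> need not be \<open>y\<close>,
      so these two null points are discarded; the remaining levels of the window lie strictly inside
      the jump.\<close>
    have ae: "AE u in lborel. u \<in> {0<..<1} \<and> I u = y \<longleftrightarrow> u \<in> {?a y..?b y}"
      using AE_lborel_singleton[of "?a y"] AE_lborel_singleton[of "?b y"]
    proof eventually_elim
      case (elim u)
      have "0 < u \<and> u < 1" if "?a y \<le> u" "u \<le> ?b y"
        using that elim measure_nonneg[of M "{..<y}"] prob_le_1[of "{..y}"] by linarith
      with elim pseudoinverse_eqI[of u y] cdf_pseudoinverse_bounds[of u] show ?case
        by auto
    qed
    have restr: "(\<integral>\<^sup>+ u. ennreal (g u) * indicator (?A y) u \<partial>\<Omega>)
      = (\<integral>\<^sup>+ u. ennreal (g u) * indicator {?a y..?b y} u \<partial>lborel)" for g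
    proof -
      have "(\<integral>\<^sup>+ u. ennreal (g u) * indicator (?A y) u \<partial>\<Omega>)
        = (\<integral>\<^sup>+ u. ennreal (g u) * indicator (?A y) u * indicator {0<..<1} u \<partial>lborel)"
        unfolding \<Omega>_def by (subst nn_integral_restrict_space) simp_all
      also have "\<dots> = (\<integral>\<^sup>+ u. ennreal (g u) * indicator {?a y..?b y} u \<partial>lborel)"
      proof (rule nn_integral_cong_AE)
        show "AE u in lborel. ennreal (g u) * indicator (?A y) u * indicator {0<..<1} u
          = ennreal (g u) * indicator {?a y..?b y} u"
          using ae by eventually_elim (auto simp: sp split: split_indicator)
      qed
      finally show ?thesis .
    qed
    have "emeasure ?\<mu> (?A y) = (\<integral>\<^sup>+ u. ennreal (?h (I u)) * indicator (?A y) u \<partial>\<Omega>)"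
      by (simp add: emeasure_density)
    also have "\<dots> = (\<integral>\<^sup>+ u. ennreal (?h y) * indicator (?A y) u \<partial>\<Omega>)"
      by (intro nn_integral_cong) (auto split: split_indicator)
    \<comment> \<open>On the fibre the average is constant, and multiplying it by the length of the
      window cancels the division by \<open>?b y - ?a y\<close>.\<close>
    also have "\<dots> = ennreal (?h y) * ennreal (?b y - ?a y)"
      unfolding restr using ab by (simp add: nn_integral_cmult)
    also have "\<dots> = ennreal (LBINT u:{?a y..?b y}. w u)"
      using lt h0[of y] by (simp add: ennreal_mult'[symmetric] window_avg_def)
    also have "\<dots> = (\<integral>\<^sup>+ u. ennreal (w u) * indicator {?a y..?b y} u \<partial>lborel)"
      using nn_integral_eq_integral[OF antimono_set_integrable[OF w, unfolded set_integrable_def], of "?a y" "?b y"] w(2)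
      by (simp add: set_lebesgue_integral_def nn_integral_set_ennreal mult.commute)
    also have "\<dots> = emeasure ?\<nu> (?A y)"
      by (simp add: emeasure_density restr)
    finally show ?thesis .
  qed
  have regular: "emeasure ?\<mu> ?B = emeasure ?\<nu> ?B"
  proof -
    \<comment> \<open>Without a jump at \<open>I u\<close>, both ends of the window are squeezed to
      \<open>u\<close>, and the degenerate branch of \<open>window_avg\<close> returns
      \<open>w u\<close>.\<close>
    have "?h (I u) = w u" if "u \<in> ?B" for u
    proof -
      have "?a (I u) = ?b (I u)" "?a (I u) \<le> u" "u \<le> ?b (I u)"
        using that cdf_pseudoinverse_bounds[of u] by (auto simp: S_def sp)
      then have "?b (I u) = u" "?a (I u) = ?b (I u)"
        by auto
      then show ?thesis
        by (simp add: window_avg_def)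
    qed
    then have "(\<integral>\<^sup>+ u. ennreal (?h (I u)) * indicator ?B u \<partial>\<Omega>)
      = (\<integral>\<^sup>+ u. ennreal (w u) * indicator ?B u \<partial>\<Omega>)"
      by (intro nn_integral_cong) (auto split: split_indicator)
    then show ?thesis
      by (simp add: emeasure_density)
  qed
  have "(\<integral>\<^sup>+ y. ennreal (g y) \<partial>M) = (\<integral>\<^sup>+ u. ennreal (g (I u)) \<partial>\<Omega>)"
    if [measurable]: "g \<in> borel_measurable borel" for g
    using nn_integral_distr[of I \<Omega> borel "\<lambda>y. ennreal (g y)"] distr_I_eq_M
    by (simp add: \<Omega>_def[symmetric])
  then have "(\<integral>\<^sup>+ y. ennreal (?h y) \<partial>M) = (\<integral>\<^sup>+ u. ennreal (?h (I u)) \<partial>\<Omega>)"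
    by simp
  also have "\<dots> = emeasure ?\<mu> (space \<Omega>)"
    by (subst emeasure_density) (auto intro!: nn_integral_cong)
  also have "space \<Omega> = (\<Union>y\<in>S. ?A y) \<union> ?B"
    by auto
  also have "emeasure ?\<mu> \<dots> = emeasure ?\<mu> (\<Union>y\<in>S. ?A y) + emeasure ?\<mu> ?B"
    using UA by (intro plus_emeasure[symmetric]) auto
  also have "emeasure ?\<mu> (\<Union>y\<in>S. ?A y) = (\<integral>\<^sup>+ y. emeasure ?\<mu> (?A y) \<partial>count_space S)"
    using cS by (intro emeasure_UN_countable) (auto simp: disjoint_family_on_def)
  also have "\<dots> = (\<integral>\<^sup>+ y. emeasure ?\<nu> (?A y) \<partial>count_space S)"
    using atom by (intro nn_integral_cong) simp
  also have "\<dots> = emeasure ?\<nu> (\<Union>y\<in>S. ?A y)"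
    using cS by (intro emeasure_UN_countable[symmetric]) (auto simp: disjoint_family_on_def)
  also note regular
  also have "emeasure ?\<nu> (\<Union>y\<in>S. ?A y) + emeasure ?\<nu> ?B = emeasure ?\<nu> ((\<Union>y\<in>S. ?A y) \<union> ?B)"
    using UA by (intro plus_emeasure) auto
  also have "(\<Union>y\<in>S. ?A y) \<union> ?B = space \<Omega>"
    by auto
  also have "emeasure ?\<nu> (space \<Omega>) = (\<integral>\<^sup>+ u. ennreal (w u) \<partial>\<Omega>)"
    by (subst emeasure_density) (auto intro!: nn_integral_cong)
  also have "\<dots> = (\<integral>\<^sup>+ u. ennreal (w u) * indicator {0<..<1} u \<partial>lborel)"
    unfolding \<Omega>_def by (subst nn_integral_restrict_space) simp_all
  also have "\<dots> = (\<integral>\<^sup>+ u. ennreal (w u) * indicator {0..1} u \<partial>lborel)"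
    using AE_lborel_singleton[of "0::real"] AE_lborel_singleton[of "1::real"]
    by (intro nn_integral_cong_AE) (auto split: split_indicator)
  also have "\<dots> = ennreal (LBINT u:{0..1}. w u)"
    using nn_integral_eq_integral[OF antimono_set_integrable[OF w, unfolded set_integrable_def], of 0 1] w(2)
    by (simp add: set_lebesgue_integral_def nn_integral_set_ennreal mult.commute)
  finally show ?thesis .
qed

end

section \<open>Extended-real integrals\<close>

lemma eln_measurable [measurable]: "eln \<in> borel_measurable borel"
  unfolding eln_def by measurable

lemma eln_ereal: "eln (ereal r) = (if r \<le> 0 then -\<infinity> else ereal (ln r))"
  by (simp add: eln_def)

lemma ext_integral_cong_AE:
  assumes "AE x in N. g x = h x"
  shows "ext_integral N g = ext_integral N h"
proof -
  have "(\<integral>\<^sup>+ x. e2ennreal (g x) \<partial>N) = (\<integral>\<^sup>+ x. e2ennreal (h x) \<partial>N)"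
    "(\<integral>\<^sup>+ x. e2ennreal (- g x) \<partial>N) = (\<integral>\<^sup>+ x. e2ennreal (- h x) \<partial>N)"
    using assms by (auto intro!: nn_integral_cong_AE)
  then show ?thesis
    by (simp add: ext_integral_def)
qed

lemma ext_integral_ereal:
  assumes "integrable N g"
  shows "ext_integral N (\<lambda>x. ereal (g x)) = ereal (\<integral>x. g x \<partial>N)"
proof -
  obtain a b where "0 \<le> a" "0 \<le> b" "(\<integral>\<^sup>+ x. ennreal (g x) \<partial>N) = ennreal a"
    "(\<integral>\<^sup>+ x. ennreal (- g x) \<partial>N) = ennreal b" "(\<integral>x. g x \<partial>N) = a - b"
    using assms by (rule integrableE)
  then show ?thesis
    by (simp add: ext_integral_def)
qed

text \<open>A nonnegative real factor commutes with taking positive and negative parts. This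
  includes the factor \<open>0\<close> at infinite values, where both sides are
  \<open>0\<close>.\<close>

lemma ext_integral_density:
  assumes [measurable]: "h \<in> borel_measurable M" "g \<in> borel_measurable M"
    and h: "\<And>x. x \<in> space M \<Longrightarrow> 0 \<le> h x"
  shows "ext_integral (density M (\<lambda>x. ennreal (h x))) g = ext_integral M (\<lambda>x. g x * ereal (h x))"
proof -
  have e: "ennreal r * e2ennreal y = e2ennreal (y * ereal r)" if "0 \<le> r" for y r
  proof (cases y)
    case (real s)
    with that show ?thesis
      by (cases "0 \<le> s") (auto simp: ennreal_mult[symmetric] mult.commute ennreal_neg mult_le_0_iff)
  next
    case PInf
    with that show ?thesis
      by (cases "r = 0") (auto simp: ennreal_mult_top e2ennreal_neg)
  next
    case MInf
    with that show ?thesis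
      by (cases "r = 0") (auto simp: e2ennreal_neg)
  qed
  have [measurable]: "e2ennreal \<in> borel_measurable borel"
    by (intro borel_measurable_continuous_onI continuous_on_e2ennreal)
  have "(\<integral>\<^sup>+ x. e2ennreal (g x) \<partial>density M (\<lambda>x. ennreal (h x)))
      = (\<integral>\<^sup>+ x. e2ennreal (g x * ereal (h x)) \<partial>M)"
    "(\<integral>\<^sup>+ x. e2ennreal (- g x) \<partial>density M (\<lambda>x. ennreal (h x)))
      = (\<integral>\<^sup>+ x. e2ennreal (- (g x * ereal (h x))) \<partial>M)"
    using h by (auto simp: nn_integral_density e intro!: nn_integral_cong)
  then show ?thesis
    by (simp add: ext_integral_def)
qed

text \<open>Finite parts force \<open>g\<close> to be finite almost everywhere, so
  \<open>real_of_ereal\<close>, which sends both infinities to \<open>0\<close>, alters it only on a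
  null set.\<close>

lemma ext_integral_finite:
  assumes [measurable]: "g \<in> borel_measurable N"
    and fin: "(\<integral>\<^sup>+ x. e2ennreal (g x) \<partial>N) \<noteq> \<infinity>" "(\<integral>\<^sup>+ x. e2ennreal (- g x) \<partial>N) \<noteq> \<infinity>"
  shows "AE x in N. \<bar>g x\<bar> \<noteq> \<infinity>" "integrable N (\<lambda>x. real_of_ereal (g x))"
    "ext_integral N g = ereal (\<integral>x. real_of_ereal (g x) \<partial>N)"
proof -
  have [measurable]: "e2ennreal \<in> borel_measurable borel"
    by (intro borel_measurable_continuous_onI continuous_on_e2ennreal)
  have "AE x in N. e2ennreal (g x) \<noteq> \<infinity>" "AE x in N. e2ennreal (- g x) \<noteq> \<infinity>"
    using nn_integral_PInf_AE[of "\<lambda>x. e2ennreal (g x)" N]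
      nn_integral_PInf_AE[of "\<lambda>x. e2ennreal (- g x)" N] fin by simp_all
  then show real: "AE x in N. \<bar>g x\<bar> \<noteq> \<infinity>"
  proof eventually_elim
    case (elim x)
    then show ?case
      by (cases "g x") auto
  qed
  have eq: "(\<integral>\<^sup>+ x. ennreal (real_of_ereal (g x)) \<partial>N) = (\<integral>\<^sup>+ x. e2ennreal (g x) \<partial>N)"
    "(\<integral>\<^sup>+ x. ennreal (- real_of_ereal (g x)) \<partial>N) = (\<integral>\<^sup>+ x. e2ennreal (- g x) \<partial>N)"
    using real by (auto intro!: nn_integral_cong_AE elim!: eventually_mono)
  show int: "integrable N (\<lambda>x. real_of_ereal (g x))"
    using fin by (simp add: real_integrable_def eq)
  have "ext_integral N g = ext_integral N (\<lambda>x. ereal (real_of_ereal (g x)))"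
    using real by (intro ext_integral_cong_AE) (auto elim!: eventually_mono simp: ereal_real)
  with ext_integral_ereal[OF int] show "ext_integral N g = ereal (\<integral>x. real_of_ereal (g x) \<partial>N)"
    by simp
qed

text \<open>Adding \<open>u \<ge> 0\<close> raises a positive part by at most
  \<open>u\<close>.\<close>

lemma e2ennreal_le_add:
  assumes "a \<le> b + ereal u" "0 \<le> u"
  shows "e2ennreal a \<le> e2ennreal b + ennreal u"
proof (cases b)
  case (real r)
  have "e2ennreal a \<le> e2ennreal (ereal (r + u))"
    using assms real by (intro e2ennreal_mono) simp
  also have "\<dots> \<le> ennreal (max 0 r + u)"
    by (simp add: ennreal_leI)
  also have "\<dots> = e2ennreal b + ennreal u"
    using assms real by (simp add: ennreal_plus ennreal_max_0)
  finally show ?thesis .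
next
  case MInf
  with assms show ?thesis
    by (simp add: e2ennreal_neg)
qed simp

text \<open>
  The inequality \<open>ln (p s) \<le> ln (p t) + p s / p t\<close> makes the positive part of one objective
  and the negative part of the other controlled by an integrable \<open>u\<close>, so that a strict
  inequality between two objectives forces both to be genuine finite integrals.
\<close>

lemma ext_integral_less_finite:
  assumes [measurable]: "g \<in> borel_measurable N" "h \<in> borel_measurable N"
    and u: "integrable N u" "AE x in N. 0 \<le> u x"
    and le: "AE x in N. h x \<le> g x + ereal (u x)"
    and less: "ext_integral N g < ext_integral N h"
  shows "(\<integral>\<^sup>+ x. e2ennreal (g x) \<partial>N) \<noteq> \<infinity>" "(\<integral>\<^sup>+ x. e2ennreal (- g x) \<partial>N) \<noteq> \<infinity>"
    "(\<integral>\<^sup>+ x. e2ennreal (h x) \<partial>N) \<noteq> \<infinity>" "(\<integral>\<^sup>+ x. e2ennreal (- h x) \<partial>N) \<noteq> \<infinity>"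
proof -
  have [measurable]: "e2ennreal \<in> borel_measurable borel"
    by (intro borel_measurable_continuous_onI continuous_on_e2ennreal)
  have [measurable]: "u \<in> borel_measurable N"
    using u by auto
  have U: "(\<integral>\<^sup>+ x. ennreal (u x) \<partial>N) \<noteq> \<infinity>"
    using u(1) by (simp add: real_integrable_def)
  \<comment> \<open>An infinite positive part would make \<open>ext_integral N g\<close> equal to
    \<infinity>, whatever the negative part, and nothing is strictly above that.\<close>
  show gp: "(\<integral>\<^sup>+ x. e2ennreal (g x) \<partial>N) \<noteq> \<infinity>"
    using less by (auto simp: ext_integral_def)
  have "(\<integral>\<^sup>+ x. e2ennreal (h x) \<partial>N) \<le> (\<integral>\<^sup>+ x. e2ennreal (g x) + ennreal (u x) \<partial>N)"
    using le u(2) by (intro nn_integral_mono_AE, eventually_elim) (rule e2ennreal_le_add)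
  also have "\<dots> = (\<integral>\<^sup>+ x. e2ennreal (g x) \<partial>N) + (\<integral>\<^sup>+ x. ennreal (u x) \<partial>N)"
    by (intro nn_integral_add) auto
  also have "\<dots> < \<infinity>"
    using gp U by (simp add: less_top)
  finally show hp: "(\<integral>\<^sup>+ x. e2ennreal (h x) \<partial>N) \<noteq> \<infinity>"
    by simp
  \<comment> \<open>With a finite positive part, an infinite negative part would give -\<infinity>,
    and nothing is strictly below that.\<close>
  show hm: "(\<integral>\<^sup>+ x. e2ennreal (- h x) \<partial>N) \<noteq> \<infinity>"
  proof
    assume "(\<integral>\<^sup>+ x. e2ennreal (- h x) \<partial>N) = \<infinity>"
    moreover have "\<bar>enn2ereal (\<integral>\<^sup>+ x. e2ennreal (h x) \<partial>N)\<bar> \<noteq> \<infinity>"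
      using hp by (cases "\<integral>\<^sup>+ x. e2ennreal (h x) \<partial>N") auto
    ultimately have "ext_integral N h = -\<infinity>"
      by (cases "enn2ereal (\<integral>\<^sup>+ x. e2ennreal (h x) \<partial>N)") (auto simp: ext_integral_def)
    with less show False
      by simp
  qed
  \<comment> \<open>Exchanging the roles of the two functions under negation bounds the negative
    part of \<open>g\<close> by that of \<open>h\<close>.\<close>
  have neg: "- a \<le> - b + ereal c" if "b \<le> a + ereal c" for a b c
    using that by (cases a; cases b) auto
  have "(\<integral>\<^sup>+ x. e2ennreal (- g x) \<partial>N) \<le> (\<integral>\<^sup>+ x. e2ennreal (- h x) + ennreal (u x) \<partial>N)"
    using le u(2) by (intro nn_integral_mono_AE, eventually_elim) (intro e2ennreal_le_add neg)
  also have "\<dots> = (\<integral>\<^sup>+ x. e2ennreal (- h x) \<partial>N) + (\<integral>\<^sup>+ x. ennreal (u x) \<partial>N)"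
    by (intro nn_integral_add) auto
  also have "\<dots> < \<infinity>"
    using hm U by (simp add: less_top)
  finally show "(\<integral>\<^sup>+ x. e2ennreal (- g x) \<partial>N) \<noteq> \<infinity>"
    by simp
qed

section \<open>One step of the algorithm\<close>

text \<open>This is \<open>ln y \<le> y - 1\<close> at \<open>y = a / b\<close>, multiplied by
  \<open>b\<close>, with equality only at \<open>y = 1\<close>. Summed over two weight vectors of
  equal total, the left sides cancel.\<close>

lemma gibbs_term:
  fixes a b :: real
  assumes "0 < a" "0 < b"
  shows "b - a \<le> b * ln (b / a)" "a \<noteq> b \<Longrightarrow> b - a < b * ln (b / a)"
proof -
  have eq: "b * ln (b / a) = b * (- ln (a / b))" "b - a = b * (- (a / b - 1))"
    using assms by (auto simp: ln_div field_simps)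
  have "ln (a / b) \<le> a / b - 1"
    using assms by (intro ln_le_minus_one) simp
  then show "b - a \<le> b * ln (b / a)"
    unfolding eq using assms by (intro mult_left_mono) auto
  assume "a \<noteq> b"
  then have "ln (a / b) \<noteq> a / b - 1"
    using assms ln_eq_minus_one[of "a / b"] by auto
  with \<open>ln (a / b) \<le> a / b - 1\<close> show "b - a < b * ln (b / a)"
    unfolding eq using assms by (intro mult_strict_left_mono) auto
qed

lemma prob_density_mixture:
  assumes dens: "\<And>s. s \<in> \<Theta> \<Longrightarrow> prob_density M (p s)"
    and \<theta>: "\<theta> \<in> mixture_params J \<Theta>"
  shows "prob_density M (mixture p J \<theta>)"
proof -
  obtain l t where lt: "\<theta> = (l, t)"
    by (cases \<theta>)
  have l: "0 \<le> l j" and d: "prob_density M (p (t j))" if "j \<in> {1..J}" for j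
    using that \<theta> dens by (auto simp: mixture_params_def lt)
  have m: "(\<lambda>x. l j * p (t j) x) \<in> borel_measurable M" if "j \<in> {1..J}" for j
    using d[OF that] by (auto simp: prob_density_def)
  have [measurable]: "mixture p J \<theta> \<in> borel_measurable M"
    unfolding mixture_def[abs_def] lt using m by simp
  have nonneg: "0 \<le> mixture p J \<theta> x" if "x \<in> space M" for x
    unfolding mixture_def lt using l d that by (auto simp: prob_density_def intro!: sum_nonneg)
  have "(\<integral>\<^sup>+ x. ennreal (mixture p J \<theta> x) \<partial>M) = (\<integral>\<^sup>+ x. (\<Sum>j=1..J. ennreal (l j * p (t j) x)) \<partial>M)"
    using l d unfolding mixture_def lt
    by (intro nn_integral_cong) (auto simp: prob_density_def intro!: sum_ennreal[symmetric])
  also have "\<dots> = (\<Sum>j=1..J. \<integral>\<^sup>+ x. ennreal (l j * p (t j) x) \<partial>M)"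
    using m by (intro nn_integral_sum) auto
  also have "\<dots> = (\<Sum>j=1..J. ennreal (l j))"
  proof (intro sum.cong refl)
    fix j assume j: "j \<in> {1..J}"
    have [measurable]: "p (t j) \<in> borel_measurable M"
      using d[OF j] by (simp add: prob_density_def)
    have "(\<integral>\<^sup>+ x. ennreal (l j * p (t j) x) \<partial>M) = (\<integral>\<^sup>+ x. ennreal (l j) * ennreal (p (t j) x) \<partial>M)"
      using l[OF j] d[OF j] by (intro nn_integral_cong) (auto simp: prob_density_def ennreal_mult)
    also have "\<dots> = ennreal (l j)"
      using d[OF j] by (simp add: nn_integral_cmult prob_density_def)
    finally show "(\<integral>\<^sup>+ x. ennreal (l j * p (t j) x) \<partial>M) = ennreal (l j)" .
  qed
  also have "\<dots> = ennreal (\<Sum>j=1..J. l j)"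
    using l by (intro sum_ennreal) auto
  also have "\<dots> = 1"
    using \<theta> by (simp add: mixture_params_def lt)
  finally show ?thesis
    using nonneg by (simp add: prob_density_def)
qed

text \<open>The target enters only as a probability density dominated by a multiple of the current
  mixture. It is instantiated with \<open>C = w 0 / Z_w w\<close>.\<close>

locale em_step =
  fixes M :: "'a measure" and p :: "'b \<Rightarrow> 'a \<Rightarrow> real" and \<Theta> :: "'b set" and J :: nat
    and l :: "nat \<Rightarrow> real" and t :: "nat \<Rightarrow> 'b" and \<pi> :: "'a \<Rightarrow> real" and C :: real
  assumes dens: "\<And>s. s \<in> \<Theta> \<Longrightarrow> prob_density M (p s)"
    and params: "(l, t) \<in> mixture_params J \<Theta>"
    and target_density: "prob_density M \<pi>"
    and dominated: "\<And>x. x \<in> space M \<Longrightarrow> \<pi> x \<le> C * mixture p J (l, t) x"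
begin

abbreviation q :: "'a \<Rightarrow> real" where "q \<equiv> mixture p J (l, t)"
abbreviation \<rho> :: "nat \<Rightarrow> 'a \<Rightarrow> real" where "\<rho> \<equiv> resp p J (l, t)"
abbreviation N :: "'a measure" where "N \<equiv> density M (\<lambda>x. ennreal (\<pi> x))"
abbreviation obj :: "nat \<Rightarrow> 'b \<Rightarrow> ereal" where
  "obj j s \<equiv> ext_integral N (\<lambda>x. eln (ereal (p s x)) * ereal (\<rho> j x))"

section \<open>Elementary properties of densities and responsibilities\<close>

lemma l_nonneg: "j \<in> {1..J} \<Longrightarrow> 0 \<le> l j"
  and t_in: "j \<in> {1..J} \<Longrightarrow> t j \<in> \<Theta>"
  and sum_l: "(\<Sum>j=1..J. l j) = 1"
  using params by (auto simp: mixture_params_def)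

lemma p_measurable [measurable]: "s \<in> \<Theta> \<Longrightarrow> p s \<in> borel_measurable M"
  and p_nonneg: "s \<in> \<Theta> \<Longrightarrow> x \<in> space M \<Longrightarrow> 0 \<le> p s x"
  and p_integral: "s \<in> \<Theta> \<Longrightarrow> (\<integral>\<^sup>+ x. ennreal (p s x) \<partial>M) = 1"
  using dens by (auto simp: prob_density_def)

lemma \<pi>_measurable [measurable]: "\<pi> \<in> borel_measurable M"
  and \<pi>_nonneg: "x \<in> space M \<Longrightarrow> 0 \<le> \<pi> x"
  and \<pi>_integral: "(\<integral>\<^sup>+ x. ennreal (\<pi> x) \<partial>M) = 1"
  using target_density by (auto simp: prob_density_def)

lemma q_density: "prob_density M q"
  using dens params by (rule prob_density_mixture)

lemma q_measurable [measurable]: "q \<in> borel_measurable M"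
  and q_nonneg: "x \<in> space M \<Longrightarrow> 0 \<le> q x"
  using q_density by (auto simp: prob_density_def)

lemma resp_eq: "\<rho> j x = l j * p (t j) x / q x"
  by (simp add: resp_def mixture_def)

lemma resp_measurable [measurable]: "j \<in> {1..J} \<Longrightarrow> \<rho> j \<in> borel_measurable M"
  using t_in unfolding resp_eq[abs_def] by simp

lemma C_nonneg: "0 \<le> C"
proof (rule ccontr)
  assume "\<not> 0 \<le> C"
  then have "\<pi> x \<le> 0" if "x \<in> space M" for x
    using dominated[OF that] q_nonneg[OF that] by (smt (verit) mult_nonpos_nonneg)
  then have "(\<integral>\<^sup>+ x. ennreal (\<pi> x) \<partial>M) = (\<integral>\<^sup>+ x. 0 \<partial>M)"
    by (intro nn_integral_cong) (simp add: ennreal_neg)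
  with \<pi>_integral show False
    by simp
qed

sublocale N: prob_space N
  by (rule prob_spaceI) (auto simp: emeasure_density \<pi>_integral cong: nn_integral_cong)

text \<open>\<open>N\<close> does not charge the zeros of \<open>\<pi>\<close>, and where
  \<open>\<pi>\<close> is positive the domination forces \<open>q\<close> to be positive. Divisions
  by either and their logarithms are therefore genuine almost everywhere.\<close>

lemma AE_support: "AE x in N. x \<in> space M \<and> 0 < \<pi> x \<and> 0 < q x"
proof -
  have "AE x in M. ennreal (\<pi> x) > 0 \<longrightarrow> x \<in> space M \<and> 0 < \<pi> x \<and> 0 < q x"
  proof (rule AE_I2, rule impI)
    fix x assume x: "x \<in> space M" "ennreal (\<pi> x) > 0"
    then have "0 < \<pi> x"
      by simp
    with dominated[OF x(1)] q_nonneg[OF x(1)] have "q x \<noteq> 0"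
      by auto
    with q_nonneg[OF x(1)] \<open>0 < \<pi> x\<close> x(1) show "x \<in> space M \<and> 0 < \<pi> x \<and> 0 < q x"
      by simp
  qed
  then show ?thesis
    by (simp add: AE_density)
qed

lemma resp_nonneg: "j \<in> {1..J} \<Longrightarrow> x \<in> space M \<Longrightarrow> 0 \<le> \<rho> j x"
  using l_nonneg p_nonneg[OF t_in] q_nonneg by (simp add: resp_eq)

lemma sum_resp: "0 < q x \<Longrightarrow> (\<Sum>j=1..J. \<rho> j x) = 1"
  unfolding resp_eq sum_divide_distrib[symmetric] by (simp add: mixture_def)

lemma resp_le_1:
  assumes "j \<in> {1..J}" "x \<in> space M"
  shows "\<rho> j x \<le> 1"
\<comment> \<open>At a zero of \<open>q\<close> the quotient defining the responsibility is
  \<open>0\<close> by convention.\<close>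
proof (cases "q x = 0")
  case False
  have "\<rho> j x \<le> (\<Sum>i=1..J. \<rho> i x)"
    using assms resp_nonneg by (intro member_le_sum) auto
  also have "\<dots> = 1"
    using False q_nonneg[OF assms(2)] by (intro sum_resp) auto
  finally show ?thesis .
qed (simp add: resp_eq)

lemma integrable_resp: "j \<in> {1..J} \<Longrightarrow> integrable N (\<rho> j)"
  using resp_nonneg resp_le_1
  by (intro N.integrable_const_bound[where B = 1]) (auto intro!: AE_I2)

lemma sum_integral_resp: "(\<Sum>j=1..J. \<integral>x. \<rho> j x \<partial>N) = 1"
proof -
  have "(\<Sum>j=1..J. \<integral>x. \<rho> j x \<partial>N) = (\<integral>x. (\<Sum>j=1..J. \<rho> j x) \<partial>N)"
    using integrable_resp by (intro Bochner_Integration.integral_sum[symmetric]) auto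
  also have "\<dots> = (\<integral>x. 1 \<partial>N)"
  proof (intro integral_cong_AE)
    show "AE x in N. (\<Sum>j=1..J. \<rho> j x) = 1"
      using AE_support by eventually_elim (blast intro: sum_resp)
  qed simp_all
  finally show ?thesis
    using N.prob_space by simp
qed

text \<open>The density of \<open>N\<close> cancels the denominator where \<open>\<pi>\<close> is
  positive and contributes \<open>0\<close> elsewhere, so the integral is at most that of
  \<open>h\<close> over \<open>M\<close>.\<close>

lemma integrable_ratio:
  assumes [measurable]: "h \<in> borel_measurable M" and h: "\<And>x. x \<in> space M \<Longrightarrow> 0 \<le> h x"
    and fin: "(\<integral>\<^sup>+ x. ennreal (h x) \<partial>M) < \<infinity>"
  shows "integrable N (\<lambda>x. h x / \<pi> x)"
proof (rule integrableI_nonneg)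
  show "AE x in N. 0 \<le> h x / \<pi> x"
    using h \<pi>_nonneg by (intro AE_I2) auto
  have "(\<integral>\<^sup>+ x. ennreal (h x / \<pi> x) \<partial>N) = (\<integral>\<^sup>+ x. ennreal (\<pi> x) * ennreal (h x / \<pi> x) \<partial>M)"
    by (simp add: nn_integral_density)
  also have "\<dots> \<le> (\<integral>\<^sup>+ x. ennreal (h x) \<partial>M)"
    using h \<pi>_nonneg by (intro nn_integral_mono) (simp add: ennreal_mult[symmetric])
  finally show "(\<integral>\<^sup>+ x. ennreal (h x / \<pi> x) \<partial>N) < \<infinity>"
    using fin by simp
qed simp

text \<open>On the support of \<open>N\<close>, domination gives
  \<open>1 / q x \<le> C / \<pi> x\<close>.\<close>

lemma integrable_ratio_q:
  assumes [measurable]: "h \<in> borel_measurable M" and h: "\<And>x. x \<in> space M \<Longrightarrow> 0 \<le> h x"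
    and fin: "(\<integral>\<^sup>+ x. ennreal (h x) \<partial>M) < \<infinity>"
  shows "integrable N (\<lambda>x. h x / q x)"
proof (rule Bochner_Integration.integrable_bound)
  show "integrable N (\<lambda>x. C * (h x / \<pi> x))"
    using integrable_ratio[OF assms] by (rule integrable_mult_right)
  show "AE x in N. norm (h x / q x) \<le> norm (C * (h x / \<pi> x))"
    using AE_support
  proof eventually_elim
    case (elim x)
    then have "1 / q x \<le> C / \<pi> x"
      using dominated[of x] by (simp add: field_simps)
    then have "h x * (1 / q x) \<le> h x * (C / \<pi> x)"
      using elim h by (intro mult_left_mono) auto
    with elim h[of x] C_nonneg show ?case
      by (simp add: ac_simps)
  qed
qed simp

text \<open>Objectives are extended reals that may be infinite; this turns a strict improvement into
  a positive integral of a real function, which can enter the Jensen-type bound.\<close>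

lemma objective_improvement:
  assumes j: "j \<in> {1..J}" and s: "s \<in> \<Theta>" and less: "obj j (t j) < obj j s"
  defines "d \<equiv> \<lambda>x. \<rho> j x * (ln (p s x) - ln (p (t j) x))"
  shows "AE x in N. 0 < \<rho> j x \<longrightarrow> 0 < p s x" "integrable N d" "0 < (\<integral>x. d x \<partial>N)"
proof -
  note [measurable] = p_measurable[OF s] p_measurable[OF t_in[OF j]] resp_measurable[OF j]
  let ?g = "\<lambda>s x. eln (ereal (p s x)) * ereal (\<rho> j x)"
  \<comment> \<open>This is \<open>\<rho> j x * (p s x / p (t j) x)\<close> after cancelling the
    factor \<open>p (t j) x\<close> of the responsibility; domination makes it integrable although
    the ratio of components need not be.\<close>
  let ?u = "\<lambda>x. l j * (p s x / q x)"
  have u: "integrable N ?u"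
    using p_integral[OF s]
    by (intro integrable_mult_right integrable_ratio_q p_measurable[OF s] p_nonneg[OF s]) simp_all
  have u0: "AE x in N. 0 \<le> ?u x"
    using l_nonneg[OF j] p_nonneg[OF s] q_nonneg by (intro AE_I2) simp
  have le: "AE x in N. ?g s x \<le> ?g (t j) x + ereal (?u x)"
    using AE_support u0
  proof eventually_elim
    case (elim x)
    show ?case
    proof (cases "\<rho> j x = 0")
      case True
      then show ?thesis
        using elim by (simp add: zero_ereal_def[symmetric])
    next
      case False
      then have r: "0 < \<rho> j x"
        using resp_nonneg[OF j, of x] elim by simp
      have "l j \<noteq> 0" "p (t j) x \<noteq> 0"
        using False by (auto simp: resp_eq)
      then have pt: "0 < p (t j) x"
        using p_nonneg[OF t_in[OF j], of x] elim by simp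
      show ?thesis
      proof (cases "p s x \<le> 0")
        case True
        then show ?thesis
          using r by (simp add: eln_ereal)
      next
        case False
        have "\<rho> j x * ln (p s x / p (t j) x) \<le> \<rho> j x * (p s x / p (t j) x - 1)"
          using False pt r by (intro mult_left_mono ln_le_minus_one) auto
        also have "\<dots> \<le> \<rho> j x * (p s x / p (t j) x)"
          using r by (intro mult_left_mono) auto
        also have "\<dots> = ?u x"
          using pt by (simp add: resp_eq)
        finally show ?thesis
          using False pt by (simp add: eln_ereal ln_div algebra_simps)
      qed
    qed
  qed
  have m: "?g s \<in> borel_measurable N" "?g (t j) \<in> borel_measurable N"
    by simp_all
  note fin = ext_integral_less_finite[OF m(2,1) u u0 le less]
  note fs = ext_integral_finite[OF m(1) fin(3,4)] and ft = ext_integral_finite[OF m(2) fin(1,2)]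
  \<comment> \<open>Where \<open>p s\<close> vanishes but the responsibility does not, the integrand
    is -\<infinity>; finiteness of the objective makes this set null.\<close>
  show pos: "AE x in N. 0 < \<rho> j x \<longrightarrow> 0 < p s x"
    using fs(1)
  proof eventually_elim
    case (elim x)
    then show ?case
      by (auto simp: eln_ereal split: if_splits)
  qed
  have d: "AE x in N. real_of_ereal (?g s x) - real_of_ereal (?g (t j) x) = d x"
    using pos AE_support
  proof eventually_elim
    case (elim x)
    show ?case
    proof (cases "\<rho> j x = 0")
      case False
      then have "0 < \<rho> j x"
        using resp_nonneg[OF j, of x] elim by simp
      moreover have "0 < p (t j) x"
        using False p_nonneg[OF t_in[OF j], of x] elim by (auto simp: resp_eq less_le)
      ultimately show ?thesis
        using elim by (simp add: d_def eln_ereal algebra_simps)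
    qed (simp add: d_def zero_ereal_def[symmetric])
  qed
  have i: "integrable N (\<lambda>x. real_of_ereal (?g s x) - real_of_ereal (?g (t j) x))"
    using fs(2) ft(2) by (rule Bochner_Integration.integrable_diff)
  have [measurable]: "d \<in> borel_measurable N"
    unfolding d_def by simp
  show "integrable N d"
    using i by (rule integrable_cong_AE_imp) (use d in simp_all)
  have "(\<integral>x. d x \<partial>N) = (\<integral>x. real_of_ereal (?g s x) - real_of_ereal (?g (t j) x) \<partial>N)"
    using d by (intro integral_cong_AE) (auto elim!: eventually_mono)
  also have "\<dots> = (\<integral>x. real_of_ereal (?g s x) \<partial>N) - (\<integral>x. real_of_ereal (?g (t j) x) \<partial>N)"
    using fs(2) ft(2) by (rule Bochner_Integration.integral_diff)
  finally show "0 < (\<integral>x. d x \<partial>N)"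
    using less fs(3) ft(3) by simp
qed

section \<open>Divergences as finite integrals against the target\<close>

lemma KL_eq_integral:
  assumes [measurable]: "h \<in> borel_measurable M" and pos: "AE x in N. 0 < h x"
    and int: "integrable N (\<lambda>x. ln (\<pi> x / h x))"
  shows "KL M \<pi> h = ereal (\<integral>x. ln (\<pi> x / h x) \<partial>N)"
proof -
  have "KL M \<pi> h = ext_integral N (\<lambda>x. eln (ereal (\<pi> x) / ereal (h x)))"
    unfolding KL_def using \<pi>_nonneg by (intro ext_integral_density[symmetric]) auto
  also have "\<dots> = ext_integral N (\<lambda>x. ereal (ln (\<pi> x / h x)))"
  proof (intro ext_integral_cong_AE)
    show "AE x in N. eln (ereal (\<pi> x) / ereal (h x)) = ereal (ln (\<pi> x / h x))"
      using pos AE_support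
    proof eventually_elim
      case (elim x)
      then show ?case
        by (auto simp: eln_ereal divide_le_0_iff)
    qed
  qed
  also have "\<dots> = ereal (\<integral>x. ln (\<pi> x / h x) \<partial>N)"
    using int by (rule ext_integral_ereal)
  finally show ?thesis .
qed

text \<open>Domination bounds the logarithm above by \<open>C\<close>; applying
  \<open>ln y \<le> y - 1\<close> to the inverse ratio bounds it below by
  \<open>- (q x / \<pi> x)\<close>, which is integrable because \<open>q\<close> is a
  density.\<close>

lemma integrable_ln_target_ratio: "integrable N (\<lambda>x. ln (\<pi> x / q x))"
proof (rule Bochner_Integration.integrable_bound)
  show "integrable N (\<lambda>x. C + q x / \<pi> x)"
    using integrable_ratio[OF q_measurable q_nonneg] q_density by (simp add: prob_density_def)
  show "AE x in N. norm (ln (\<pi> x / q x)) \<le> norm (C + q x / \<pi> x)"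
    using AE_support
  proof eventually_elim
    case (elim x)
    have "ln (\<pi> x / q x) \<le> \<pi> x / q x - 1" "ln (q x / \<pi> x) \<le> q x / \<pi> x - 1"
      using elim by (auto intro!: ln_le_minus_one)
    moreover have "ln (q x / \<pi> x) = - ln (\<pi> x / q x)"
      using elim by (simp add: ln_div)
    moreover have "\<pi> x / q x \<le> C"
      using elim dominated[of x] by (simp add: field_simps)
    moreover have "0 \<le> q x / \<pi> x"
      using elim by simp
    moreover have "0 \<le> C"
      by (rule C_nonneg)
    ultimately show ?case
      unfolding real_norm_def by linarith
  qed
qed simp

text \<open>
  \<open>ln (q' / q)\<close> is at least the responsibility-weighted sum of the component-wise
  log ratios \<open>ln (z j)\<close>, because \<open>\<Sum>j. \<rho> j * ln (z j / z) \<le> \<Sum>j. \<rho> j * (z j / z - 1) \<le> 0\<close> for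
  \<open>z j = l' j * p (t' j) / (l j * p (t j))\<close> and \<open>z = q' / q\<close>.
\<close>

lemma ln_mixture_ratio_ge:
  assumes x: "x \<in> space M" "0 < q x"
    and l': "\<And>j. j \<in> {1..J} \<Longrightarrow> 0 < l j \<and> 0 < l' j"
    and t': "\<And>j. j \<in> {1..J} \<Longrightarrow> t' j \<in> \<Theta>"
    and pos: "\<And>j. j \<in> {1..J} \<Longrightarrow> 0 < \<rho> j x \<Longrightarrow> 0 < p (t' j) x"
  shows "0 < mixture p J (l', t') x"
    "(\<Sum>j=1..J. \<rho> j x * ln (l' j / l j) + \<rho> j x * (ln (p (t' j) x) - ln (p (t j) x)))
      \<le> ln (mixture p J (l', t') x / q x)"
proof -
  let ?q' = "mixture p J (l', t') x"
  have q': "?q' = (\<Sum>j=1..J. l' j * p (t' j) x)"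
    by (simp add: mixture_def)
  have nn: "0 \<le> l' j * p (t' j) x" if "j \<in> {1..J}" for j
    using l'[OF that] p_nonneg[OF t'[OF that] x(1)] by simp
  \<comment> \<open>One component with positive responsibility is enough to make the new mixture
    positive at \<open>x\<close>.\<close>
  have "\<exists>j\<in>{1..J}. 0 < \<rho> j x"
  proof (rule ccontr)
    assume "\<not> ?thesis"
    then have "(\<Sum>j=1..J. \<rho> j x) \<le> 0"
      by (intro sum_nonpos) (auto simp: not_less)
    with sum_resp[OF x(2)] show False
      by simp
  qed
  then obtain i where i: "i \<in> {1..J}" "0 < \<rho> i x"
    by auto
  have "0 < l' i * p (t' i) x"
    using l'[OF i(1)] pos[OF i] by simp
  also have "\<dots> \<le> ?q'"
    unfolding q' using nn i by (intro member_le_sum) auto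
  finally show q'_pos: "0 < ?q'" .
  have "\<rho> j x * ln (l' j / l j) + \<rho> j x * (ln (p (t' j) x) - ln (p (t j) x)) - \<rho> j x * ln (?q' / q x)
      \<le> l' j * p (t' j) x / ?q' - \<rho> j x" if j: "j \<in> {1..J}" for j
  proof (cases "\<rho> j x = 0")
    case True
    then show ?thesis
      using nn[OF j] q'_pos by simp
  next
    case False
    then have r: "0 < \<rho> j x"
      using resp_nonneg[OF j x(1)] by simp
    have pt: "0 < p (t j) x"
      using False p_nonneg[OF t_in[OF j] x(1)] by (auto simp: resp_eq less_le)
    have lj: "0 < l j" "0 < l' j" "0 < p (t' j) x"
      using l'[OF j] pos[OF j r] by auto
    \<comment> \<open>This is the component ratio divided by the mixture ratio; the weight
      \<open>\<rho> j x\<close> cancels its denominator, leaving the responsibility of component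
      \<open>j\<close> under the new mixture.\<close>
    let ?z = "l' j * p (t' j) x * q x / (l j * p (t j) x * ?q')"
    have ln_z: "ln ?z = ln (l' j / l j) + (ln (p (t' j) x) - ln (p (t j) x)) - ln (?q' / q x)"
      using lj pt x(2) q'_pos by (simp add: ln_divide_pos ln_mult_pos)
    have "\<rho> j x * ln (l' j / l j) + \<rho> j x * (ln (p (t' j) x) - ln (p (t j) x))
        - \<rho> j x * ln (?q' / q x) = \<rho> j x * ln ?z"
      unfolding ln_z by (simp only: distrib_left right_diff_distrib)
    also have "\<dots> \<le> \<rho> j x * (?z - 1)"
      using lj pt x(2) q'_pos r by (intro mult_left_mono ln_le_minus_one) auto
    also have "\<dots> = l' j * p (t' j) x / ?q' - \<rho> j x"
      using lj pt x(2) q'_pos by (simp add: resp_eq field_simps)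
    finally show ?thesis .
  qed
  then have "(\<Sum>j=1..J. \<rho> j x * ln (l' j / l j) + \<rho> j x * (ln (p (t' j) x) - ln (p (t j) x))
      - \<rho> j x * ln (?q' / q x)) \<le> (\<Sum>j=1..J. l' j * p (t' j) x / ?q' - \<rho> j x)"
    by (rule sum_mono)
  also have "\<dots> = 0"
    using q'_pos sum_resp[OF x(2)] by (simp add: sum_subtractf sum_divide_distrib[symmetric]) (simp add: mixture_def)
  finally show "(\<Sum>j=1..J. \<rho> j x * ln (l' j / l j) + \<rho> j x * (ln (p (t' j) x) - ln (p (t j) x)))
      \<le> ln (?q' / q x)"
    using sum_resp[OF x(2)] by (simp add: sum_subtractf sum_distrib_right[symmetric])
qed

text \<open>Positivity of old and new weights makes the log ratios \<open>ln (l' j / l j)\<close>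
  meaningful; vanishing weights are excluded separately in the theorem.\<close>

lemma KL_decrease:
  assumes l': "\<And>j. j \<in> {1..J} \<Longrightarrow> l' j = (\<integral>x. \<rho> j x \<partial>N)"
    and pos: "\<And>j. j \<in> {1..J} \<Longrightarrow> 0 < l j \<and> 0 < l' j"
    and t': "\<And>j. j \<in> {1..J} \<Longrightarrow> t' j \<in> \<Theta>"
    and improve: "\<And>j. j \<in> {1..J} \<Longrightarrow> t' j = t j \<or> obj j (t j) < obj j (t' j)"
    and changed: "\<not> (\<forall>j\<in>{1..J}. l' j = l j \<and> t' j = t j)"
  shows "\<exists>\<Delta>>0. KL M \<pi> (mixture p J (l', t')) + ereal \<Delta> \<le> KL M \<pi> q"
proof -
  let ?q' = "mixture p J (l', t')"
  let ?d = "\<lambda>j x. \<rho> j x * (ln (p (t' j) x) - ln (p (t j) x))"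
  have sum_l': "(\<Sum>j=1..J. l' j) = 1"
    using sum_integral_resp l' by simp
  have "(l', t') \<in> mixture_params J \<Theta>"
  proof -
    have "l' j \<le> 1" if "j \<in> {1..J}" for j
      using sum_l' member_le_sum[of j "{1..J}" l'] that pos by (auto simp: less_imp_le)
    then show ?thesis
      using sum_l' pos t' by (auto simp: mixture_params_def less_imp_le)
  qed
  with dens have q'_density: "prob_density M ?q'"
    by (rule prob_density_mixture)
  then have [measurable]: "?q' \<in> borel_measurable M"
    by (simp add: prob_density_def)
  have d: "integrable N (?d j)" "0 \<le> (\<integral>x. ?d j x \<partial>N)" "t' j \<noteq> t j \<Longrightarrow> 0 < (\<integral>x. ?d j x \<partial>N)"
    "AE x in N. 0 < \<rho> j x \<longrightarrow> 0 < p (t' j) x" if j: "j \<in> {1..J}" for j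
  proof -
    \<comment> \<open>This covers components whose parameter stays put: a positive responsibility
      contains the factor \<open>p (t j) x\<close>.\<close>
    have same: "AE x in N. 0 < \<rho> j x \<longrightarrow> 0 < p (t j) x"
      using AE_support
    proof eventually_elim
      case (elim x)
      then show ?case
        using p_nonneg[OF t_in[OF j], of x] by (auto simp: resp_eq less_le)
    qed
    show "integrable N (?d j)" "0 \<le> (\<integral>x. ?d j x \<partial>N)" "t' j \<noteq> t j \<Longrightarrow> 0 < (\<integral>x. ?d j x \<partial>N)"
      "AE x in N. 0 < \<rho> j x \<longrightarrow> 0 < p (t' j) x"
      using improve[OF j] objective_improvement[OF j t'[OF j]] same by (auto simp: less_imp_le)
  qed
  have "AE x in N. \<forall>j\<in>{1..J}. 0 < \<rho> j x \<longrightarrow> 0 < p (t' j) x"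
    using d(4) by (intro AE_finite_allI) auto
  with AE_support have bound: "AE x in N. 0 < ?q' x \<and>
      (\<Sum>j=1..J. \<rho> j x * ln (l' j / l j) + ?d j x) \<le> ln (?q' x / q x)"
  proof eventually_elim
    case (elim x)
    then show ?case
      using ln_mixture_ratio_ge[of x l' t'] pos t' by auto
  qed
  let ?m = "\<lambda>x. \<Sum>j=1..J. \<rho> j x * ln (l' j / l j) + ?d j x"
  have m: "integrable N ?m"
    using d(1) integrable_resp by (intro Bochner_Integration.integrable_sum) auto
  \<comment> \<open>The lower bound \<open>?m\<close> is integrable, and from above the logarithm is
    at most \<open>?q' x / q x\<close>, integrable by domination.\<close>
  have L: "integrable N (\<lambda>x. ln (?q' x / q x))"
  proof (rule Bochner_Integration.integrable_bound)
    show "integrable N (\<lambda>x. \<bar>?m x\<bar> + ?q' x / q x)"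
      using m q'_density
      by (intro Bochner_Integration.integrable_add integrable_abs integrable_ratio_q)
        (auto simp: prob_density_def)
    show "AE x in N. norm (ln (?q' x / q x)) \<le> norm (\<bar>?m x\<bar> + ?q' x / q x)"
      using bound AE_support
    proof eventually_elim
      case (elim x)
      have "ln (?q' x / q x) \<le> ?q' x / q x - 1" "0 \<le> ?q' x / q x"
        using elim by (auto intro!: ln_le_minus_one)
      with elim show ?case
        unfolding real_norm_def by linarith
    qed
  qed simp
  have split: "AE x in N. ln (\<pi> x / q x) - ln (?q' x / q x) = ln (\<pi> x / ?q' x)"
    using bound AE_support by eventually_elim (simp add: ln_div)
  have K: "integrable N (\<lambda>x. ln (\<pi> x / ?q' x))"
    using Bochner_Integration.integrable_diff[OF integrable_ln_target_ratio L]
    by (rule integrable_cong_AE_imp) (use split in simp_all)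
  have "KL M \<pi> ?q' = ereal (\<integral>x. ln (\<pi> x / ?q' x) \<partial>N)"
    using bound K by (intro KL_eq_integral) (auto elim!: eventually_mono)
  also have "(\<integral>x. ln (\<pi> x / ?q' x) \<partial>N) = (\<integral>x. ln (\<pi> x / q x) - ln (?q' x / q x) \<partial>N)"
    using split by (intro integral_cong_AE) (auto elim!: eventually_mono)
  also have "\<dots> = (\<integral>x. ln (\<pi> x / q x) \<partial>N) - (\<integral>x. ln (?q' x / q x) \<partial>N)"
    using integrable_ln_target_ratio L by (rule Bochner_Integration.integral_diff)
  finally have KL': "KL M \<pi> ?q' = ereal ((\<integral>x. ln (\<pi> x / q x) \<partial>N) - (\<integral>x. ln (?q' x / q x) \<partial>N))" .
  have KL: "KL M \<pi> q = ereal (\<integral>x. ln (\<pi> x / q x) \<partial>N)"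
    using AE_support integrable_ln_target_ratio by (intro KL_eq_integral) (auto elim!: eventually_mono)
  \<comment> \<open>The witness is the integral of \<open>?m\<close>, with the integrals of the
    responsibilities replaced by \<open>l' j\<close>.\<close>
  let ?\<Delta> = "\<Sum>j=1..J. l' j * ln (l' j / l j) + (\<integral>x. ?d j x \<partial>N)"
  have "?\<Delta> = (\<Sum>j=1..J. \<integral>x. \<rho> j x * ln (l' j / l j) + ?d j x \<partial>N)"
    using d(1) integrable_resp l' by (intro sum.cong refl) simp
  also have "\<dots> = (\<integral>x. ?m x \<partial>N)"
    using d(1) integrable_resp by (intro Bochner_Integration.integral_sum[symmetric]) auto
  also have "\<dots> \<le> (\<integral>x. ln (?q' x / q x) \<partial>N)"
    using bound by (intro integral_mono_AE m L) (auto elim!: eventually_mono)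
  finally have \<Delta>: "?\<Delta> \<le> (\<integral>x. ln (?q' x / q x) \<partial>N)" .
  \<comment> \<open>The left side is \<open>0\<close> because both weight vectors sum to
    \<open>1\<close>. A changed weight gives strictness through the Gibbs term, a changed parameter
    through the integral of \<open>?d j\<close>.\<close>
  have "(\<Sum>j=1..J. l' j - l j) < ?\<Delta>"
  proof (rule sum_strict_mono_ex1)
    show "\<forall>j\<in>{1..J}. l' j - l j \<le> l' j * ln (l' j / l j) + (\<integral>x. ?d j x \<partial>N)"
      using gibbs_term(1) d(2) pos by (metis add_increasing2)
    obtain j where j: "j \<in> {1..J}" "l' j \<noteq> l j \<or> t' j \<noteq> t j"
      using changed by auto
    have "l' j - l j < l' j * ln (l' j / l j) + (\<integral>x. ?d j x \<partial>N)"
      using gibbs_term[of "l j" "l' j"] pos[OF j(1)] d(2,3)[OF j(1)] j(2) by fastforce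
    with j(1) show "\<exists>j\<in>{1..J}. l' j - l j < l' j * ln (l' j / l j) + (\<integral>x. ?d j x \<partial>N)"
      by blast
  qed simp
  then have "0 < ?\<Delta>"
    using sum_l sum_l' by (simp add: sum_subtractf)
  with \<Delta> KL KL' show ?thesis
    by (intro exI[of _ ?\<Delta>]) simp
qed

section \<open>Degenerate weights and coinciding components\<close>

lemma objective_eq_0:
  assumes "AE x in N. \<rho> j x = 0"
  shows "obj j s = 0"
proof -
  have "obj j s = ext_integral N (\<lambda>x. ereal 0)"
    using assms by (intro ext_integral_cong_AE) (auto elim!: eventually_mono simp: zero_ereal_def[symmetric])
  also have "\<dots> = ereal 0"
    by (subst ext_integral_ereal) simp_all
  finally show ?thesis
    by simp
qed

text \<open>Either condition makes the responsibility vanish almost everywhere: by its formula, or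
  as a nonnegative function with integral zero. The objective then no longer distinguishes
  parameters.\<close>

lemma objective_eq_0_if_weight_eq_0:
  assumes j: "j \<in> {1..J}" and "l j = 0 \<or> (\<integral>x. \<rho> j x \<partial>N) = 0"
  shows "obj j s = 0"
proof (rule objective_eq_0)
  show "AE x in N. \<rho> j x = 0"
  proof (cases "l j = 0")
    case False
    with assms(2) have "(\<integral>x. \<rho> j x \<partial>N) = 0"
      by simp
    moreover have "AE x in N. 0 \<le> \<rho> j x"
      using resp_nonneg[OF j] by (intro AE_I2) simp
    ultimately show ?thesis
      using integral_nonneg_eq_0_iff_AE[OF integrable_resp[OF j]] by simp
  qed (simp add: resp_eq)
qed

text \<open>When all components coincide, the mixture is that component and each responsibility
  equals its weight on the support, so the weight update is stationary.\<close>

lemma integral_resp_single: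
  assumes j: "j \<in> {1..J}" and same: "\<And>i. i \<in> {1..J} \<Longrightarrow> t i = s"
  shows "(\<integral>x. \<rho> j x \<partial>N) = l j"
proof -
  have q: "q x = p s x" for x
    using same sum_l by (simp add: mixture_def sum_distrib_right[symmetric])
  have "(\<integral>x. \<rho> j x \<partial>N) = (\<integral>x. l j \<partial>N)"
  proof (intro integral_cong_AE)
    show "AE x in N. \<rho> j x = l j"
      using AE_support by eventually_elim (simp add: resp_eq q same[OF j])
  qed (use resp_measurable[OF j] in simp_all)
  then show ?thesis
    using N.prob_space by simp
qed

end

section \<open>The target density\<close>

lemma window_avg_cong:
  assumes "\<And>u. u \<in> {0..1} \<Longrightarrow> w u = v u" "0 \<le> a" "a \<le> b" "b \<le> 1"
  shows "window_avg w a b = window_avg v a b"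
proof -
  have "(LBINT u:{a..b}. w u) = (LBINT u:{a..b}. v u)"
    using assms by (intro set_lebesgue_integral_cong) auto
  then show ?thesis
    using assms by (simp add: window_avg_def)
qed

text \<open>The values of \<open>w\<close> outside the unit interval are arbitrary, hence the clamping.\<close>

lemma antimono_clamp:
  fixes w :: "real \<Rightarrow> real"
  assumes "antimono_on {0..1} w"
  shows "antimono (\<lambda>u. w (max 0 (min 1 u)))"
  using assms by (auto simp: monotone_on_def)

text \<open>\<open>W_f\<close> depends on \<open>x\<close> only through \<open>f x\<close>, so
  normalisation can be checked under the law of \<open>f\<close>, where the averaged weight
  integrates to \<open>Z_w w\<close>. Bounding averages by \<open>w 0\<close> gives the
  domination.\<close>

lemma target_properties:
  assumes f: "f \<in> borel_measurable M"
    and dens: "prob_density M (mixture p J \<theta>)"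
    and w: "\<And>u. u \<in> {0..1} \<Longrightarrow> 0 \<le> w u" "antimono_on {0..1} w" and Z: "Z_w w > 0"
  shows "prob_density M (target M f w p J \<theta>)"
    and "x \<in> space M \<Longrightarrow> target M f w p J \<theta> x \<le> w 0 / Z_w w * mixture p J \<theta> x"
proof -
  note [measurable] = f
  let ?q = "mixture p J \<theta>"
  let ?P = "density M (\<lambda>y. ennreal (?q y))"
  define v where "v = (\<lambda>u. w (max 0 (min 1 u)))"
  define h where "h = (\<lambda>y. window_avg v (measure (distr ?P borel f) {..<y}) (measure (distr ?P borel f) {..y}))"
  have v: "antimono v" "\<And>u. 0 \<le> v u"
    unfolding v_def using antimono_clamp[OF w(2)] w(1) by auto
  have vw: "v u = w u" if "u \<in> {0..1}" for u
    using that by (simp add: v_def)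
  have q[measurable]: "?q \<in> borel_measurable M" and q0: "\<And>x. x \<in> space M \<Longrightarrow> 0 \<le> ?q x"
    and q1: "(\<integral>\<^sup>+ x. ennreal (?q x) \<partial>M) = 1"
    using dens by (auto simp: prob_density_def)
  interpret P: prob_space ?P
    by (rule prob_spaceI) (auto simp: emeasure_density q1 cong: nn_integral_cong)
  interpret D: prob_space "distr ?P borel f"
    by (rule P.prob_space_distr) simp
  interpret D: cdf_distribution "distr ?P borel f"
    by (intro cdf_distribution.intro real_distribution.intro D.prob_space_axioms
        real_distribution_axioms.intro) simp_all
  have qs: "q_less M f p J \<theta> x = measure (distr ?P borel f) {..<f x}"
    "q_le M f p J \<theta> x = measure (distr ?P borel f) {..f x}" for x
    unfolding q_less_def q_le_def
    by (auto simp: measure_distr vimage_def intro!: arg_cong[where f = "measure ?P"])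
  have mono: "measure (distr ?P borel f) {..<y} \<le> measure (distr ?P borel f) {..y}" for y
    by (intro D.finite_measure_mono) auto
  have W: "W_f M f w p J \<theta> x = h (f x)" for x
  proof -
    have "W_f M f w p J \<theta> x
        = window_avg w (measure (distr ?P borel f) {..<f x}) (measure (distr ?P borel f) {..f x})"
      by (simp add: W_f_def Let_def window_avg_def qs)
    also have "\<dots> = h (f x)"
      unfolding h_def using vw mono by (intro window_avg_cong) auto
    finally show ?thesis .
  qed
  have [measurable]: "h \<in> borel_measurable borel"
    unfolding h_def
    by (intro borel_measurable_antimono antimono_window_avg_cdf v D.real_distribution_axioms)
  have h0: "0 \<le> h y" and hw: "h y \<le> w 0" for y
  proof -
    show "0 \<le> h y"
      unfolding h_def using window_avg_bounds(1)[OF v mono] v(2) order_trans by blast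
    have "h y \<le> v (measure (distr ?P borel f) {..<y})"
      unfolding h_def by (rule window_avg_bounds(2)[OF v mono])
    also have "\<dots> \<le> v 0"
      using v(1) by (rule antimonoD) simp
    finally show "h y \<le> w 0"
      by (simp add: vw)
  qed
  have t: "target M f w p J \<theta> x = h (f x) / Z_w w * ?q x" for x
    by (simp add: target_def W)
  show "target M f w p J \<theta> x \<le> w 0 / Z_w w * ?q x" if "x \<in> space M"
    unfolding t using Z hw q0[OF that] by (intro mult_right_mono divide_right_mono) auto
  have Zv: "(LBINT u:{0..1}. v u) = Z_w w"
    unfolding Z_w_def using vw by (intro set_lebesgue_integral_cong) auto
  have "(\<integral>\<^sup>+ x. ennreal (target M f w p J \<theta> x) \<partial>M)
      = (\<integral>\<^sup>+ x. ennreal (1 / Z_w w) * (ennreal (?q x) * ennreal (h (f x))) \<partial>M)"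
    unfolding t using h0 q0 Z
    by (intro nn_integral_cong) (simp add: ennreal_mult'[symmetric] mult.commute)
  also have "\<dots> = ennreal (1 / Z_w w) * (\<integral>\<^sup>+ x. ennreal (?q x) * ennreal (h (f x)) \<partial>M)"
    by (intro nn_integral_cmult) simp
  also have "(\<integral>\<^sup>+ x. ennreal (?q x) * ennreal (h (f x)) \<partial>M) = (\<integral>\<^sup>+ y. ennreal (h y) \<partial>distr ?P borel f)"
    by (simp add: nn_integral_distr nn_integral_density)
  also have "\<dots> = ennreal (Z_w w)"
    unfolding h_def Zv[symmetric] by (rule D.nn_integral_window_avg_cdf[OF v])
  also have "ennreal (1 / Z_w w) * ennreal (Z_w w) = 1"
    using Z by (simp add: ennreal_mult'[symmetric])
  finally have "(\<integral>\<^sup>+ x. ennreal (target M f w p J \<theta> x) \<partial>M) = 1" .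
  then show "prob_density M (target M f w p J \<theta>)"
    unfolding prob_density_def t using h0 q0 Z by auto
qed

lemma mixture_cong:
  assumes "\<And>j. j \<in> {1..J} \<Longrightarrow> l' j = l j \<and> t' j = t j"
  shows "mixture p J (l', t') = mixture p J (l, t)"
  using assms by (auto simp: mixture_def fun_eq_iff intro!: sum.cong)

theorem proposition6:
  fixes M :: "'a measure" and f :: "'a \<Rightarrow> real" and w :: "real \<Rightarrow> real"
    and p :: "'b \<Rightarrow> 'a \<Rightarrow> real" and \<Theta> :: "'b set" and J :: nat
    and lam :: "nat \<Rightarrow> nat \<Rightarrow> real" and th :: "nat \<Rightarrow> nat \<Rightarrow> 'b"
  assumes "f \<in> borel_measurable M"
    and "\<And>t. t \<in> \<Theta> \<Longrightarrow> prob_density M (p t)"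
    and "\<And>u. u \<in> {0..1} \<Longrightarrow> 0 \<le> w u"
    and "antimono_on {0..1} w"
    and "Z_w w > 0"
    and "mixture_ML_sequence M f w p \<Theta> J (\<lambda>k. (lam k, th k))"
    and "\<And>k j. j \<in> {1..J} \<Longrightarrow>
           \<exists>!t. is_arg_max (objective M f w p J (lam k, th k) j) (\<lambda>t. t \<in> \<Theta>) t"
  shows "\<forall>k. \<exists>\<Delta>::real.
           KL M (target M f w p J (lam k, th k)) (mixture p J (lam (Suc k), th (Suc k))) + ereal \<Delta>
             \<le> KL M (target M f w p J (lam k, th k)) (mixture p J (lam k, th k)) \<and>
           (if \<forall>j\<in>{1..J}. lam (Suc k) j = lam k j \<and> th (Suc k) j = th k j
            then \<Delta> = 0 else \<Delta> > 0)"
proof -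
  note f = assms(1) and dens = assms(2) and w = assms(3-5) and seq = assms(6) and unique = assms(7)
  have step: "em_step M p \<Theta> J (lam k) (th k) (target M f w p J (lam k, th k)) (w 0 / Z_w w)"
    if "(lam k, th k) \<in> mixture_params J \<Theta>" for k
    using target_properties[OF f prob_density_mixture[OF dens that] w] dens that
    by (intro em_step.intro) auto
  have lam_Suc: "lam (Suc k) j = (\<integral>x. resp p J (lam k, th k) j x \<partial>density M
        (\<lambda>x. ennreal (target M f w p J (lam k, th k) x)))" if "j \<in> {1..J}" for j k
    using seq that by (auto simp: mixture_ML_sequence_def target_measure_def)
  have arg_max: "is_arg_max (objective M f w p J (lam k, th k) j) (\<lambda>t. t \<in> \<Theta>) (th (Suc k) j)"
    if "j \<in> {1..J}" for j k
    using seq that by (auto simp: mixture_ML_sequence_def)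
  then have th_Suc: "th (Suc k) j \<in> \<Theta>" if "j \<in> {1..J}" for j k
    using that by (auto simp: is_arg_max_def)
  \<comment> \<open>Feasibility is inherited: maximizers lie in \<open>\<Theta>\<close>, and the new
    weights are integrals of nonnegative functions that sum to \<open>1\<close> almost
    everywhere.\<close>
  have iterate: "(lam k, th k) \<in> mixture_params J \<Theta>" for k
  proof (induction k)
    case 0
    show ?case
      using seq by (simp add: mixture_ML_sequence_def)
  next
    case (Suc k)
    interpret em_step M p \<Theta> J "lam k" "th k" "target M f w p J (lam k, th k)" "w 0 / Z_w w"
      by (rule step) fact
    have sum: "(\<Sum>j=1..J. lam (Suc k) j) = 1"
      using sum_integral_resp by (simp add: lam_Suc)
    have nonneg: "0 \<le> lam (Suc k) j" if "j \<in> {1..J}" for j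
      unfolding lam_Suc[OF that] using resp_nonneg[OF that] by (intro integral_nonneg_AE AE_I2) simp
    have "lam (Suc k) j \<le> 1" if "j \<in> {1..J}" for j
      using member_le_sum[of j "{1..J}" "lam (Suc k)"] nonneg sum that by auto
    with sum nonneg th_Suc show ?case
      by (auto simp: mixture_params_def)
  qed
  show ?thesis
  proof
    fix k
    interpret em_step M p \<Theta> J "lam k" "th k" "target M f w p J (lam k, th k)" "w 0 / Z_w w"
      by (rule step) (rule iterate)
    have obj: "objective M f w p J (lam k, th k) j = obj j" for j
      by (simp add: fun_eq_iff objective_def target_measure_def)
    let ?same = "\<forall>j\<in>{1..J}. lam (Suc k) j = lam k j \<and> th (Suc k) j = th k j"
    show "\<exists>\<Delta>::real. KL M (target M f w p J (lam k, th k)) (mixture p J (lam (Suc k), th (Suc k)))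
          + ereal \<Delta> \<le> KL M (target M f w p J (lam k, th k)) (mixture p J (lam k, th k)) \<and>
        (if ?same then \<Delta> = 0 else \<Delta> > 0)"
    proof (cases ?same)
      case True
      \<comment> \<open>Agreement on \<open>{1..J}\<close> makes the two mixtures equal as
        functions, even if the parameter pairs differ off this index set.\<close>
      then have "mixture p J (lam (Suc k), th (Suc k)) = mixture p J (lam k, th k)"
        by (intro mixture_cong) auto
      then show ?thesis
        using True by (intro exI[of _ 0]) auto
    next
      case False
      have pos: "0 < lam k j \<and> 0 < lam (Suc k) j" if j: "j \<in> {1..J}" for j
      proof (rule ccontr)
        assume "\<not> ?thesis"
        moreover have "0 \<le> lam i j" for i
          using iterate[of i] j by (auto simp: mixture_params_def)
        ultimately have "lam k j = 0 \<or> lam (Suc k) j = 0"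
          by (metis less_le)
        txt \<open>Then the objective of component \<open>j\<close> is constant, so \<open>\<Theta>\<close> has a single element.\<close>
        then have "obj j s = 0" for s
          using objective_eq_0_if_weight_eq_0[OF j] lam_Suc[OF j] by auto
        then have "is_arg_max (objective M f w p J (lam k, th k) j) (\<lambda>t. t \<in> \<Theta>) s" if "s \<in> \<Theta>" for s
          using that by (simp add: obj is_arg_max_def)
        then have single: "s = s'" if "s \<in> \<Theta>" "s' \<in> \<Theta>" for s s'
          using unique[OF j, of k] that by blast
        have th: "th k i = th k j" if "i \<in> {1..J}" for i
          using single t_in[OF that] t_in[OF j] by blast
        \<comment> \<open>With a single available parameter all components coincide, so neither
          weights nor parameters move, against the case assumption.\<close>
        have "lam (Suc k) i = lam k i \<and> th (Suc k) i = th k i" if i: "i \<in> {1..J}" for i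
          using integral_resp_single[OF i th] lam_Suc[OF i] single th_Suc[OF i] t_in[OF i] by auto
        with False show False
          by blast
      qed
      \<comment> \<open>Without strict improvement the old parameter would itself be a maximizer,
        and uniqueness would identify it with the new one.\<close>
      have improve: "th (Suc k) j = th k j \<or> obj j (th k j) < obj j (th (Suc k) j)"
        if j: "j \<in> {1..J}" for j
      proof (rule ccontr)
        assume contr: "\<not> ?thesis"
        then have "is_arg_max (obj j) (\<lambda>t. t \<in> \<Theta>) (th k j)"
          using arg_max[OF j, of k] t_in[OF j] unfolding obj is_arg_max_def
          by (meson not_less order_le_less_trans)
        with contr unique[OF j, of k] arg_max[OF j, of k] show False
          unfolding obj by blast
      qed
      obtain \<Delta> where "0 < \<Delta>" "KL M (target M f w p J (lam k, th k))
          (mixture p J (lam (Suc k), th (Suc k))) + ereal \<Delta>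
          \<le> KL M (target M f w p J (lam k, th k)) (mixture p J (lam k, th k))"
        using KL_decrease[OF lam_Suc pos th_Suc improve False] by auto
      with False show ?thesis
        by auto
    qed
  qed
qed

end
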